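(* Let $l\ge 2$ and $j\ge 2$ be integers, and let $(M,N)\in\mathcal{L}$ with $N\ge 0$ and $(j-1)l-1\le M\le jl-2$ (equivalently, $M\geq 0$ and $j=\big[\frac{M+1}{l}+1\big]\ge 2$). Let $$M^{j}_{(M,N)}=Z\big(L_N((0,0)\to(M,N)\;|\;\mathcal{W}_0^L,\mathcal{F}_{l-1}^1,\{\mathcal{F}_{(n+1)l-1}^2\}_{n\ge 1})\big)$$ be the weighted number of lattice paths from $(0,0)$ to $(M,N)$ subject to the left wall restriction $\mathcal{W}_0^L$, the type 1 filter restriction $\mathcal{F}^1_{l-1}$ and the type 2 filter restrictions $\mathcal{F}^2_{nl-1}$ for all $n=2,3,\dots$. Then $$M^{j}_{(M,N)} = 2^{j-2}\Big(\sum_{k=0}^{\left[\frac{N-(j-1)l+1}{4l}\right]}P_j(k) F^{(N)}_{M+4kl}+\sum_{k=0}^{\left[\frac{N-jl}{4l}\right]}P_j(k)F^{(N)}_{M-4kl-2jl} -\sum_{k=0}^{\left[\frac{N-(j+1)l+1}{4l}\right]}Q_j(k)F^{(N)}_{M+2l+4kl}-\sum_{k=0}^{\left[\frac{N-(j+2)l}{4l}\right]}Q_j(k)F^{(N)}_{M-4kl-2(j+1)l} \Big),$$ where $$P_j(k)=\sum_{i=0}^{\left[\frac{j}{2}\right]}\binom{j-2}{2i}\binom{k-i+j-2}{j-2},\qquad Q_j(k)=\sum_{i=0}^{\left[\frac{j}{2}\right]}\binom{j-2}{2i+1}\binom{k-i+j-2}{j-2},$$ $$F_M^{(N)}= \b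inom{N}{\frac{N-M}{2}}-\binom{N}{\frac{N-M}{2}-1}.$$
   Context: Lattice and paths. $\mathcal{L}=\{(n,m)\in\mathbb{Z}^2 : n+m\equiv 0 \bmod 2\}$. A lattice path is a finite sequence of points of $\mathcal{L}$ in which each step is either a right step $(x,y)\to(x+1,y+1)$ or a left step $(x,y)\to(x-1,y+1)$. Restrictions (each holds for all $y$): - Left wall $\mathcal{W}_0^L$: from points $(0,y)$ the only allowed step is $(0,y)\to(1,y+1)$. - Type 1 filter $\mathcal{F}_d^1$ at $x=d$: from points with $x=d$ or $x=d+1$ only these steps are allowed: $(d,y)\to(d+1,y+1)$ with weight 1; $(d+1,y+1)\to(d+2,y+2)$ with weight 1; $(d+1,y+1)\to(d,y+2)$ with weight 2. - Type 2 filter $\mathcal{F}_d^2$ at $x=d$: from points with $x=d-1,d,d+1$ only these steps are allowed: $(d-1,y-1)\to(d,y)$ with weight 2; $(d-1,y-1)\to(d-2,y)$ with weight 1; $(d,y)\to(d+1,y+1)$ with weight 1; $(d+1,y+1)\to(d+2,y+2)$ with weight 1; $(d+1,y+1)\to(d,y+2)$ with weight 2. All other steps are allowed with weight 1. When several restrictions are present, a step is allowed iff no restriction forbids it, and its weight is the product of the weights assigned to it by the individual filters (a filter that does not concern the step contributes 1; overlap of two filters at the same site occurs only for $l=2$). Weighted number. The weight of a path is the product of the weights of its steps (empty product $=1$). $L_N(A\to B\,|\,\mathcal{C})$ is the set of lattice paths from $A$ to $B$ obeying the restrictions $\mathcal{C}$ ($N$ is the number of steps), and $Z(L_N(A\to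 B\,|\,\mathcal{C}))$ is the sum of the weights of all paths in this set. Conventions. $[\,\cdot\,]$ is the integer part (floor); a sum whose upper limit is smaller than its lower limit is $0$; $\binom{n}{m}=0$ if $m<0$ or $0\le n<m$. The formula defining $F_M^{(N)}$ is used for all integers $M\equiv N \bmod 2$, including negative $M$. Terms of the sums defining $P_j,Q_j$ whose first binomial factor vanishes are zero. *)

theory Defs
  imports Complex_Main
begin

type_synonym point = "int \<times> int"

definition path_lattice :: "point set" where
  "path_lattice = {(n, m). even (n + m)}"

definition right_step :: "point \<Rightarrow> point \<Rightarrow> bool" where
  "right_step A B \<longleftrightarrow> B = (fst A + 1, snd A + 1)"

definition left_step :: "point \<Rightarrow> point \<Rightarrow> bool" where
  "left_step A B \<longleftrightarrow> B = (fst A - 1, snd A + 1)"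

definition steps :: "point list \<Rightarrow> (point \<times> point) list" where
  "steps p = zip p (tl p)"

definition lattice_path :: "point list \<Rightarrow> bool" where
  "lattice_path p \<longleftrightarrow> p \<noteq> [] \<and> set p \<subseteq> path_lattice \<and>
     (\<forall>(A, B) \<in> set (steps p). right_step A B \<or> left_step A B)"

datatype restriction =
    Left_Wall int
  | Filter1 int
  | Filter2 int

text \<open>
  All restrictions are invariant under shifts of the second coordinate, so a restriction is
  described by first coordinates only: the columns it controls, and a table that assigns a weight
  to each move (from column, to column) it permits out of a controlled column.
\<close>

fun columns :: "restriction \<Rightarrow> int set" where
  "columns (Left_Wall d) = {d}"
| "columns (Filter1 d) = {d, d + 1}"
| "columns (Filter2 d) = {d - 1, d, d + 1}"

fun moves :: "restriction \<Rightarrow> (int \<times> int) \<Rightarrow> int option" where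
  "moves (Left_Wall d) = [(d, d + 1) \<mapsto> 1]"
| "moves (Filter1 d) =
     [(d, d + 1) \<mapsto> 1, (d + 1, d + 2) \<mapsto> 1, (d + 1, d) \<mapsto> 2]"
| "moves (Filter2 d) =
     [(d - 1, d) \<mapsto> 2, (d - 1, d - 2) \<mapsto> 1,
      (d, d + 1) \<mapsto> 1, (d + 1, d + 2) \<mapsto> 1, (d + 1, d) \<mapsto> 2]"

definition permits :: "restriction \<Rightarrow> point \<Rightarrow> point \<Rightarrow> bool" where
  "permits r A B \<longleftrightarrow> (fst A \<in> columns r \<longrightarrow> (fst A, fst B) \<in> dom (moves r))"

definition factor :: "restriction \<Rightarrow> point \<Rightarrow> point \<Rightarrow> int" where
  "factor r A B = (case moves r (fst A, fst B) of None \<Rightarrow> 1 | Some w \<Rightarrow> w)"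

text \<open>
  A set of restrictions may be infinite; the product is therefore taken over those members that
  contribute a nontrivial factor. For a step between neighbouring columns these are at most the
  filters at distance one from its starting column, hence finitely many.
\<close>

definition step_weight :: "restriction set \<Rightarrow> point \<Rightarrow> point \<Rightarrow> int" where
  "step_weight C A B = (\<Prod>r \<in> {r \<in> C. factor r A B \<noteq> 1}. factor r A B)"

definition path_weight :: "restriction set \<Rightarrow> point list \<Rightarrow> int" where
  "path_weight C p = (\<Prod>(A, B) \<leftarrow> steps p. step_weight C A B)"

definition restricted_paths :: "nat \<Rightarrow> point \<Rightarrow> point \<Rightarrow> restriction set \<Rightarrow> point list set" where
  "restricted_paths N A B C = {p. lattice_path p \<and> hd p = A \<and> last p = B \<and>
     length (steps p) = N \<and> (\<forall>(U, V) \<in> set (steps p). \<forall>r \<in> C. permits r U V)}"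

definition weighted_number :: "nat \<Rightarrow> point \<Rightarrow> point \<Rightarrow> restriction set \<Rightarrow> int" where
  "weighted_number N A B C = (\<Sum>p \<in> restricted_paths N A B C. path_weight C p)"

definition filter_restrictions :: "int \<Rightarrow> restriction set" where
  "filter_restrictions l =
     {Left_Wall 0, Filter1 (l - 1)} \<union> {Filter2 ((n + 1) * l - 1) | n. n \<ge> 1}"

text \<open>
  The value for \<open>n < 0\<close> is immaterial: for the parameters in question a negative \<open>n\<close> occurs below
  only in products whose other factor is \<open>0\<close>.
\<close>

definition binom :: "int \<Rightarrow> int \<Rightarrow> int" where
  "binom n m = (if n < 0 \<or> m < 0 then 0 else int (nat n choose nat m))"

definition F :: "int \<Rightarrow> int \<Rightarrow> int" where
  "F N M = binom N ((N - M) div 2) - binom N ((N - M) div 2 - 1)"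

definition P :: "int \<Rightarrow> int \<Rightarrow> int" where
  "P j k = (\<Sum>i = 0..j div 2. binom (j - 2) (2 * i) * binom (k - i + j - 2) (j - 2))"

definition Q :: "int \<Rightarrow> int \<Rightarrow> int" where
  "Q j k = (\<Sum>i = 0..j div 2. binom (j - 2) (2 * i + 1) * binom (k - i + j - 2) (j - 2))"

end

theory Submission
  imports Defs "HOL-Computational_Algebra.Formal_Power_Series"
begin

text \<open>
  The proof is the reflection principle, carried from one filter to the next. Splitting off the
  last step of a path turns the weighted number into a function of \<open>(N, M)\<close> determined by a one-step
  recursion in \<open>N\<close> and its value at \<open>N = 0\<close>; it therefore suffices to exhibit a function with the same
  recursion. Away from the wall and the filters the recursion is \<open>W (N + 1) M = W N (M - 1) + W N (M + 1)\<close>,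
  which every translate of \<open>F\<close> satisfies, so a combination of translates of \<open>F\<close> is sought in every
  strip \<open>a * l - 1 \<le> M \<le> (a + 1) * l - 2\<close> between consecutive filters (\<open>a = j - 1\<close>). Two things happen
  at the borders of a strip.

  No step leads from the next filter site \<open>(a + 1) * l - 1\<close> back into the strip. The strip thus ends
  in an absorbing site, and the combination must vanish there. This is arranged by pairing each
  translate with its mirror image, because \<open>F N\<close> is odd under the reflection about \<open>- 1\<close>
  (\<open>F_reflect\<close>).

  At its first site \<open>d = a * l - 1\<close> the strip receives paths from the strip before it. If \<open>S a\<close> is the
  combination for the strip \<open>a\<close>, up to powers of \<open>2\<close>, the weights \<open>2\<close> at the filter turn the recursion
  there into \<open>S a N (d - 1) = S (a - 1) N (d - 1) + S a N (d + 1)\<close>. The left-hand side is the value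
  that the formula of the new strip assigns to a site of the old one. Let
  \<open>c a m\<close> be the coefficient of the translate by \<open>2 * l * m\<close> in \<open>S a\<close>. The condition then says
  \<open>c a m + c a (m - 1) = c (a - 1) m\<close>: every filter divides the generating
  function of the coefficients by \<open>1 + t\<close>. The left wall and the type 1 filter alone produce the
  classical images for two absorbing sites, that is \<open>1 / (1 - t)\<close>; hence the coefficients after
  \<open>a\<close> filters are those of \<open>1 / ((1 - t) * (1 + t) ^ a)\<close>.

  Finally, with \<open>b = j - 2\<close>,
  \<open>1 / ((1 - t) * (1 + t) ^ (b + 1)) = (1 - t) ^ b / (1 - t\<^sup>2) ^ (b + 1)\<close>. Expanding the numerator and the
  denominator separately shows that the even coefficients are \<open>P j\<close> and the odd ones \<open>- Q j\<close>.
\<close>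

section \<open>Decomposing a path at its last step\<close>

lemma steps_snoc: "p \<noteq> [] \<Longrightarrow> steps (p @ [B]) = steps p @ [(last p, B)]"
  by (induction p rule: induct_list012) (auto simp: steps_def)

lemma length_steps: "length (steps p) = length p - 1"
  by (simp add: steps_def)

text \<open>
  Forbidden steps get the value \<open>0\<close>, so that the sum over the last step of a path
  need not distinguish which of the two possible steps are permitted.
\<close>

definition step_value :: "restriction set \<Rightarrow> point \<Rightarrow> point \<Rightarrow> int" where
  "step_value C A B = (if \<forall>r\<in>C. permits r A B then step_weight C A B else 0)"

lemma path_weight_snoc:
  "p \<noteq> [] \<Longrightarrow> path_weight C (p @ [B]) = path_weight C p * step_weight C (last p) B"
  by (simp add: path_weight_def steps_snoc)

lemma restricted_paths_0:
  "restricted_paths 0 A B C = (if A = B \<and> A \<in> path_lattice then {[A]} else {})"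
proof (rule set_eqI)
  fix p
  show "p \<in> restricted_paths 0 A B C \<longleftrightarrow>
      p \<in> (if A = B \<and> A \<in> path_lattice then {[A]} else {})"
  proof (cases p)
    case (Cons a q)
    then show ?thesis
      by (cases q) (auto simp: restricted_paths_def lattice_path_def steps_def)
  qed (simp add: restricted_paths_def lattice_path_def)
qed

lemma snoc_in_restricted_paths_iff:
  assumes "p \<noteq> []"
  shows "p @ [B] \<in> restricted_paths (Suc N) A B C \<longleftrightarrow>
    p \<in> restricted_paths N A (last p) C \<and> B \<in> path_lattice \<and>
    (right_step (last p) B \<or> left_step (last p) B) \<and> (\<forall>r\<in>C. permits r (last p) B)"
  using assms
  by (auto simp: restricted_paths_def lattice_path_def steps_snoc)

lemma restricted_paths_Suc:
  assumes "(x, y) \<in> path_lattice"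
  shows "restricted_paths (Suc N) A (x, y) C =
    (\<Union>U \<in> {U \<in> {(x - 1, y - 1), (x + 1, y - 1)}. \<forall>r\<in>C. permits r U (x, y)}.
       (\<lambda>p. p @ [(x, y)]) ` restricted_paths N A U C)" (is "?L = ?R")
proof (intro equalityI subsetI)
  fix q assume q: "q \<in> ?L"
  define p where "p = butlast q"
  have "length q - 1 = Suc N" "last q = (x, y)"
    using q by (simp_all add: restricted_paths_def length_steps)
  then have "length q = Suc (Suc N)" by linarith
  then have p: "p \<noteq> []"
    unfolding p_def by (cases q) auto
  have qp: "q = p @ [(x, y)]"
    using append_butlast_last_id[of q] p \<open>last q = (x, y)\<close> unfolding p_def by fastforce
  have *: "p \<in> restricted_paths N A (last p) C"
    "right_step (last p) (x, y) \<or> left_step (last p) (x, y)"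
    "\<forall>r\<in>C. permits r (last p) (x, y)"
    using q unfolding qp snoc_in_restricted_paths_iff[OF p] by simp_all
  have "last p \<in> {(x - 1, y - 1), (x + 1, y - 1)}"
    using *(2) by (cases "last p") (auto simp: right_step_def left_step_def)
  then show "q \<in> ?R"
    using *(1,3) unfolding qp by (intro UN_I[of "last p"] imageI) simp_all
next
  fix q assume "q \<in> ?R"
  then obtain U p where U: "U \<in> {(x - 1, y - 1), (x + 1, y - 1)}" "\<forall>r\<in>C. permits r U (x, y)"
    and p: "p \<in> restricted_paths N A U C" and q: "q = p @ [(x, y)]"
    by blast
  have "p \<noteq> []" "last p = U"
    using p by (simp_all add: restricted_paths_def lattice_path_def)
  moreover have "right_step U (x, y) \<or> left_step U (x, y)"
    using U(1) by (auto simp: right_step_def left_step_def)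
  ultimately show "q \<in> ?L"
    unfolding q using U(2) p assms by (simp add: snoc_in_restricted_paths_iff)
qed

lemma restricted_paths_empty: "B \<notin> path_lattice \<Longrightarrow> restricted_paths N A B C = {}"
proof -
  assume "B \<notin> path_lattice"
  moreover have "B \<in> path_lattice" if "p \<in> restricted_paths N A B C" for p
  proof -
    have "p \<noteq> []" "last p = B" "set p \<subseteq> path_lattice"
      using that by (simp_all add: restricted_paths_def lattice_path_def)
    then show ?thesis using last_in_set[of p] by blast
  qed
  ultimately show ?thesis by blast
qed

lemma finite_restricted_paths: "finite (restricted_paths N A B C)"
proof (induction N arbitrary: B)
  case 0
  then show ?case by (simp add: restricted_paths_0)
next
  case (Suc N)
  show ?case
  proof (cases "B \<in> path_lattice")
    case True
    obtain x y where B: "B = (x, y)" by (cases B)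
    show ?thesis
      unfolding B restricted_paths_Suc[OF True[unfolded B]]
      by (intro finite_UN_I finite_imageI Suc.IH) simp
  qed (simp add: restricted_paths_empty)
qed

lemma sum_path_weight_snoc:
  "(\<Sum>q \<in> (\<lambda>p. p @ [B]) ` restricted_paths N A U C. path_weight C q) =
     weighted_number N A U C * step_weight C U B"
proof -
  have "(\<Sum>q \<in> (\<lambda>p. p @ [B]) ` restricted_paths N A U C. path_weight C q) =
      (\<Sum>p \<in> restricted_paths N A U C. path_weight C (p @ [B]))"
    by (simp add: sum.reindex inj_on_def)
  also have "\<dots> = (\<Sum>p \<in> restricted_paths N A U C. path_weight C p * step_weight C U B)"
  proof (intro sum.cong refl)
    fix p assume "p \<in> restricted_paths N A U C"
    then have "p \<noteq> []" "last p = U"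
      by (simp_all add: restricted_paths_def lattice_path_def)
    then show "path_weight C (p @ [B]) = path_weight C p * step_weight C U B"
      by (simp add: path_weight_snoc)
  qed
  finally show ?thesis
    by (simp add: weighted_number_def sum_distrib_right)
qed

lemma weighted_number_Suc:
  assumes "(x, y) \<in> path_lattice"
  shows "weighted_number (Suc N) A (x, y) C =
    step_value C (x - 1, y - 1) (x, y) * weighted_number N A (x - 1, y - 1) C +
    step_value C (x + 1, y - 1) (x, y) * weighted_number N A (x + 1, y - 1) C"
proof -
  let ?U = "{(x - 1, y - 1), (x + 1, y - 1)}"
  let ?V = "{U \<in> ?U. \<forall>r\<in>C. permits r U (x, y)}"
  have "weighted_number (Suc N) A (x, y) C =
      (\<Sum>U \<in> ?V. \<Sum>q \<in> (\<lambda>p. p @ [(x, y)]) ` restricted_paths N A U C. path_weight C q)"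
    unfolding weighted_number_def restricted_paths_Suc[OF assms]
  proof (rule sum.UNION_disjoint)
    show "\<forall>U\<in>?V. finite ((\<lambda>p. p @ [(x, y)]) ` restricted_paths N A U C)"
      by (simp add: finite_restricted_paths)
  qed (auto simp: restricted_paths_def)
  also have "\<dots> = (\<Sum>U \<in> ?V. weighted_number N A U C * step_weight C U (x, y))"
    by (simp only: sum_path_weight_snoc)
  also have "\<dots> = (\<Sum>U \<in> ?V. step_value C U (x, y) * weighted_number N A U C)"
    by (intro sum.cong) (auto simp: step_value_def)
  also have "\<dots> = (\<Sum>U \<in> ?U. step_value C U (x, y) * weighted_number N A U C)"
    by (intro sum.mono_neutral_left) (auto simp: step_value_def)
  finally show ?thesis
    by simp
qed

section \<open>Step values under the wall and the filters\<close>

text \<open>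
  Right steps are never forbidden, and the only ones with a nontrivial weight enter a type 2
  filter site from the left. Those sites are \<open>k * l - 1\<close> with \<open>k \<ge> 2\<close>; at \<open>k = 1\<close> there is
  the type 1 filter, which leaves this step at weight \<open>1\<close>.
\<close>

lemma step_value_right:
  fixes l x y :: int
  assumes "l \<ge> 2" "x \<ge> 0"
  shows "step_value (filter_restrictions l) (x, y) (x + 1, y') =
    (if l dvd x + 2 \<and> x + 2 \<noteq> l then 2 else 1)"
proof -
  let ?C = "filter_restrictions l"
  have perm: "\<forall>r\<in>?C. permits r (x, y) (x + 1, y')"
    by (auto simp: filter_restrictions_def permits_def)
  have fac: "factor r (x, y) (x + 1, y') = (if r = Filter2 (x + 1) then 2 else 1)" for r
    by (cases r) (auto simp: factor_def)
  have mem: "Filter2 (x + 1) \<in> ?C \<longleftrightarrow> l dvd x + 2 \<and> x + 2 \<noteq> l"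
  proof
    assume "Filter2 (x + 1) \<in> ?C"
    then obtain n where "n \<ge> 1" "x + 2 = (n + 1) * l"
      by (auto simp: filter_restrictions_def)
    then show "l dvd x + 2 \<and> x + 2 \<noteq> l"
      using assms by auto
  next
    assume d: "l dvd x + 2 \<and> x + 2 \<noteq> l"
    then obtain k where k: "x + 2 = l * k" by (auto elim: dvdE)
    have "k > 0"
      using k assms by (metis add_nonneg_pos zero_less_mult_iff not_less_iff_gr_or_eq
          zero_less_numeral less_le_trans order.asym)
    moreover have "k \<noteq> 1" using k d by auto
    ultimately have "k - 1 \<ge> 1" by linarith
    moreover have "x + 1 = ((k - 1) + 1) * l - 1" using k by (simp add: algebra_simps)
    ultimately show "Filter2 (x + 1) \<in> ?C"
      unfolding filter_restrictions_def by blast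
  qed
  have "{r \<in> ?C. factor r (x, y) (x + 1, y') \<noteq> 1} =
      (if l dvd x + 2 \<and> x + 2 \<noteq> l then {Filter2 (x + 1)} else {})"
    using mem by (auto simp: fac)
  then show ?thesis
    using perm by (simp add: step_value_def step_weight_def fac)
qed

text \<open>
  The wall and every filter site, of either type, can only be left to the right.
\<close>

lemma step_value_left_blocked:
  fixes l x y :: int
  assumes "l \<ge> 2" "x \<ge> 0" "x = 0 \<or> l dvd x + 1"
  shows "step_value (filter_restrictions l) (x, y) (x - 1, y') = 0"
proof -
  let ?C = "filter_restrictions l"
  have "\<exists>r\<in>?C. \<not> permits r (x, y) (x - 1, y')"
  proof (cases "x = 0")
    case True
    then show ?thesis
      by (intro bexI[of _ "Left_Wall 0"]) (auto simp: permits_def filter_restrictions_def)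
  next
    case False
    then obtain k where k: "x + 1 = l * k" using assms by (auto elim: dvdE)
    have "k > 0"
      using k assms by (metis add_nonneg_pos zero_less_mult_iff not_less_iff_gr_or_eq
          zero_less_one zero_less_numeral less_le_trans order.asym)
    show ?thesis
    proof (cases "k = 1")
      case True
      then show ?thesis
        using k by (intro bexI[of _ "Filter1 (l - 1)"]) (auto simp: permits_def filter_restrictions_def)
    next
      case False
      with \<open>k > 0\<close> have "k - 1 \<ge> 1" by linarith
      moreover have "x = ((k - 1) + 1) * l - 1" using k by (simp add: algebra_simps)
      ultimately have "Filter2 x \<in> ?C"
        unfolding filter_restrictions_def by blast
      then show ?thesis
        by (intro bexI[of _ "Filter2 x"]) (auto simp: permits_def)
    qed
  qed
  then show ?thesis
    by (auto simp: step_value_def)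
qed

text \<open>
  A left step from a multiple of \<open>l\<close> returns to a filter site; both filter types give it weight
  \<open>2\<close>, but only one filter sits there. This also covers \<open>l = 2\<close>, where the multiple of \<open>l\<close> is
  also controlled by the filter to its right: that filter contributes \<open>1\<close>.
\<close>

lemma step_value_left:
  fixes l x y :: int
  assumes "l \<ge> 2" "x > 0" "\<not> l dvd x + 1"
  shows "step_value (filter_restrictions l) (x, y) (x - 1, y') = (if l dvd x then 2 else 1)"
proof -
  let ?C = "filter_restrictions l"
  have perm: "\<forall>r\<in>?C. permits r (x, y) (x - 1, y')"
    using assms by (auto simp: filter_restrictions_def permits_def)
  have fac: "factor r (x, y) (x - 1, y') =
      (if r = Filter1 (x - 1) \<or> r = Filter2 (x - 1) then 2 else 1)" for r
    by (cases r) (auto simp: factor_def)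
  have set_eq: "{r \<in> ?C. factor r (x, y) (x - 1, y') \<noteq> 1} =
      (if l dvd x then {if x = l then Filter1 (x - 1) else Filter2 (x - 1)} else {})"
  proof (cases "l dvd x")
    case False
    then show ?thesis
      by (auto simp: fac filter_restrictions_def)
  next
    case True
    then obtain k where k: "x = l * k" by (auto elim: dvdE)
    have "k > 0"
      using k assms by (metis zero_less_mult_iff not_less_iff_gr_or_eq zero_less_numeral
          less_le_trans order.asym)
    show ?thesis
    proof (cases "k = 1")
      case True
      then have x: "x = l" using k by simp
      show ?thesis
        using fac assms(1) unfolding x by (auto simp: filter_restrictions_def)
    next
      case False
      with \<open>k > 0\<close> have "k - 1 \<ge> 1" by linarith
      moreover have "x - 1 = ((k - 1) + 1) * l - 1" using k by (simp add: algebra_simps)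
      ultimately have "Filter2 (x - 1) \<in> ?C"
        unfolding filter_restrictions_def by blast
      moreover have "x \<noteq> l" using k False assms by auto
      ultimately show ?thesis
        using True by (auto simp: fac filter_restrictions_def)
    qed
  qed
  show ?thesis
    using perm unfolding step_value_def step_weight_def set_eq by (auto simp: fac)
qed

section \<open>Ballot numbers and their reflection\<close>

lemma binom_Pascal:
  assumes "n \<ge> 0"
  shows "binom (n + 1) m = binom n m + binom n (m - 1)"
proof (cases "m \<le> 0")
  case True
  then show ?thesis using assms by (auto simp: binom_def)
next
  case False
  then have "nat m = Suc (nat (m - 1))" "nat (n + 1) = Suc (nat n)"
    using assms by auto
  then show ?thesis
    using assms False by (simp add: binom_def)
qed

lemma binom_symmetric: "n \<ge> 0 \<Longrightarrow> binom n (n - m) = binom n m"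
  by (cases "m \<le> n"; cases "m \<ge> 0")
     (auto simp: binom_def nat_diff_distrib binomial_eq_0 intro!: binomial_symmetric[symmetric])

text \<open>
  This is Pascal's rule; the floors in the definition of \<open>F\<close> shift consistently for both parities of
  \<open>N - M\<close>.
\<close>

lemma F_step:
  assumes "N \<ge> 0"
  shows "F (N + 1) M = F N (M - 1) + F N (M + 1)"
proof -
  have "(N + 1 - M) div 2 = (N - (M - 1)) div 2" "(N - (M + 1)) div 2 = (N + 1 - M) div 2 - 1"
    by (simp_all add: algebra_simps)
  then show ?thesis
    using assms by (simp add: F_def binom_Pascal)
qed

text \<open>
  \<open>F N\<close> is the difference of the number of free walks to \<open>M\<close> and the number of those to the
  mirror image \<open>- M - 2\<close>, hence odd under this reflection. In the formulas this is the symmetry of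
  the binomial coefficients.
\<close>

lemma F_reflect:
  assumes "N \<ge> 0" "even (N - M)" "L + M = - 2"
  shows "F N L = - F N M"
proof -
  obtain k where k: "N - M = 2 * k" using assms(2) by (rule evenE)
  have "(N - M) div 2 = k" "(N - L) div 2 = N - (k - 1)"
    using k assms(3) by presburger+
  then have "F N L = binom N (N - (k - 1)) - binom N (N - (k - 1) - 1)"
    "F N M = binom N k - binom N (k - 1)"
    by (simp_all only: F_def)
  moreover have "N - (k - 1) - 1 = N - k" by simp
  ultimately show ?thesis
    using assms(1) by (simp only: binom_symmetric)
qed

lemma F_eq_0: "N < M \<Longrightarrow> F N M = 0"
proof -
  assume "N < M"
  then have "(N - M) div 2 < 0" "(N - M) div 2 - 1 < 0" by presburger+
  moreover have "binom N q = 0" if "q < 0" for q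
    using that by (simp add: binom_def)
  ultimately show ?thesis by (simp only: F_def)
qed

lemma F_eq_0': "N \<ge> 0 \<Longrightarrow> even (N - M) \<Longrightarrow> M < - N - 2 \<Longrightarrow> F N M = 0"
  using F_reflect[of N M "- M - 2"] F_eq_0[of N "- M - 2"] by simp

section \<open>Reflection coefficients\<close>

text \<open>
  The coefficient of \<open>t ^ m\<close> in \<open>1 / ((1 - t) * (1 + t) ^ a)\<close>. The recursion expresses that
  multiplying the series for \<open>Suc a\<close> by \<open>1 + t\<close> gives the series for \<open>a\<close>.
\<close>

fun reflection_coeff :: "nat \<Rightarrow> nat \<Rightarrow> int" where
  "reflection_coeff 0 m = 1"
| "reflection_coeff (Suc a) 0 = 1"
| "reflection_coeff (Suc a) (Suc m) = reflection_coeff a (Suc m) - reflection_coeff (Suc a) m"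

lemma reflection_coeff_0_right: "reflection_coeff a 0 = 1"
  by (cases a) auto

lemma sum_lessThan_double:
  fixes f :: "nat \<Rightarrow> int"
  shows "(\<Sum>m<2 * K. f m) = (\<Sum>k<K. f (2 * k) + f (2 * k + 1))"
  by (induction K) (auto simp: algebra_simps)

lemma sum_int_atMost_eq_lessThan:
  fixes f :: "int \<Rightarrow> int"
  assumes "u < int K" "\<And>k. 0 \<le> k \<Longrightarrow> u < k \<Longrightarrow> f k = 0"
  shows "(\<Sum>k = 0..u. f k) = (\<Sum>k<K. f (int k))"
proof -
  have "(\<Sum>k<K. f (int k)) = (\<Sum>k\<in>int ` {..<K}. f k)"
    by (subst sum.reindex) auto
  also have "int ` {..<K} = {0..<int K}"
    using image_int_atLeastLessThan[of 0 K] by (simp add: lessThan_atLeast0)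
  also have "(\<Sum>k\<in>{0..<int K}. f k) = (\<Sum>k = 0..u. f k)"
    using assms by (intro sum.mono_neutral_right) auto
  finally show ?thesis ..
qed

text \<open>
  The expansion of \<open>1 / (1 - t\<^sup>2) ^ (b + 1)\<close>.
\<close>

definition even_binomial_series :: "nat \<Rightarrow> int fps" where
  "even_binomial_series b = Abs_fps (\<lambda>n. if even n then int ((n div 2 + b) choose b) else 0)"

lemma even_binomial_series_Suc:
  "(1 - fps_X ^ 2) * even_binomial_series (Suc b) = even_binomial_series b"
proof (rule fps_ext)
  fix n :: nat
  have "n = 0 \<or> n = 1 \<or> n = (n - 2) + 2" by linarith
  then consider "n = 0" | "n = 1" | m where "n = m + 2" by blast
  then show "fps_nth ((1 - fps_X ^ 2) * even_binomial_series (Suc b)) n = fps_nth (even_binomial_series b) n"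
    by cases (auto simp: left_diff_distrib fps_X_power_mult_nth even_binomial_series_def)
qed

lemma one_minus_fps_X_power_nth: "fps_nth ((1 - fps_X) ^ b :: int fps) n = (- 1) ^ n * int (b choose n)"
proof (induction b arbitrary: n)
  case 0
  then show ?case by (cases n) auto
next
  case (Suc b)
  then show ?case
    by (cases n) (auto simp: left_diff_distrib algebra_simps)
qed

text \<open>
  Writing \<open>1 / ((1 - t) * (1 + t) ^ (b + 1))\<close> as \<open>(1 - t) ^ b / (1 - t\<^sup>2) ^ (b + 1)\<close> separates the
  parities: the second factor is even. For the proof it is enough that
  \<open>(1 + t) * (1 - t) ^ (b + 1) = (1 - t) ^ b * (1 - t\<^sup>2)\<close>, so that the products satisfy the recursion
  of the coefficients.
\<close>

lemma reflection_coeff_fps: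
  "reflection_coeff (Suc b) m = fps_nth ((1 - fps_X) ^ b * even_binomial_series b) m"
proof (induction b arbitrary: m)
  case 0
  show ?case
    by (induction m) (auto simp: even_binomial_series_def)
next
  case (Suc b)
  let ?A = "\<lambda>b. (1 - fps_X) ^ b * even_binomial_series b :: int fps"
  have "(1 + x) * ((1 - x) ^ Suc b * e) = (1 - x) ^ b * ((1 - x ^ 2) * e)" for x e :: "int fps"
    by (simp add: algebra_simps power2_eq_square)
  then have flip: "(1 + fps_X) * ?A (Suc b) = ?A b"
    by (simp only: even_binomial_series_Suc)
  then have *: "fps_nth (?A b) n = fps_nth (?A (Suc b)) n + (if n = 0 then 0 else fps_nth (?A (Suc b)) (n - 1))" for n
    by (simp only: flip[symmetric] distrib_right fps_add_nth mult_1_left fps_X_mult_nth)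
  note IH = Suc.IH
  show ?case
  proof (induction m)
    case 0
    then show ?case by (simp add: fps_mult_nth_0 one_minus_fps_X_power_nth even_binomial_series_def del: power_Suc)
  next
    case (Suc m)
    then show ?case using IH[of "Suc m"] *[of "Suc m"]
      by (simp del: power_Suc)
  qed
qed

lemma binom_of_nat: "binom (int n) (int m) = int (n choose m)"
  by (simp add: binom_def)

text \<open>
  Bridge between the integer sums in \<open>P\<close> and \<open>Q\<close>, which run up to \<open>j div 2\<close> independently of \<open>k\<close>,
  and a Cauchy product, which stops at \<open>k\<close>: beyond \<open>k\<close> the second factor vanishes, and beyond
  \<open>j div 2\<close> the first does.
\<close>

lemma binomial_sum_reindex:
  assumes "\<And>i. b \<le> 2 * i \<Longrightarrow> c (Suc i) = 0" "\<And>i. g (int i) = int (c i)"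
  shows "(\<Sum>i = 0..(int b + 2) div 2. g i * binom (int k - i + int b) (int b)) =
    (\<Sum>i<Suc k. int (c i) * int ((k - i + b) choose b))"
proof -
  have "(\<Sum>i = 0..(int b + 2) div 2. g i * binom (int k - i + int b) (int b)) =
      (\<Sum>i<b + k + 2. g (int i) * binom (int k - int i + int b) (int b))"
  proof (rule sum_int_atMost_eq_lessThan)
    fix i :: int assume i: "0 \<le> i" "(int b + 2) div 2 < i"
    then obtain i' where i': "i = int (Suc i')" "b \<le> 2 * i'"
      by (intro that[of "nat (i - 1)"]) auto
    show "g i * binom (int k - i + int b) (int b) = 0"
      unfolding i' assms(2) using assms(1)[OF i'(2)] by simp
  qed auto
  also have "\<dots> = (\<Sum>i<Suc k. g (int i) * binom (int k - int i + int b) (int b))"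
    by (intro sum.mono_neutral_right) (auto simp: binom_def nat_less_iff)
  also have "\<dots> = (\<Sum>i<Suc k. int (c i) * int ((k - i + b) choose b))"
  proof (intro sum.cong refl)
    fix i assume "i \<in> {..<Suc k}"
    then have "int k - int i + int b = int (k - i + b)" by simp
    then show "g (int i) * binom (int k - int i + int b) (int b) =
        int (c i) * int ((k - i + b) choose b)"
      by (simp only: binom_of_nat assms(2))
  qed
  finally show ?thesis .
qed

text \<open>
  In the Cauchy product at an even index only the even coefficients of \<open>(1 - t) ^ b\<close> meet a
  nonzero coefficient of the even series; in \<open>Q_eq_reflection_coeff\<close> only the odd ones do, which
  accounts for the sign.
\<close>

lemma P_eq_reflection_coeff: "P (int b + 2) (int k) = reflection_coeff (Suc b) (2 * k)"
proof -
  have "P (int b + 2) (int k) = (\<Sum>i = 0..(int b + 2) div 2.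
      binom (int b) (2 * i) * binom (int k - i + int b) (int b))"
    by (simp add: P_def algebra_simps)
  also have "\<dots> = (\<Sum>i<Suc k. int (b choose (2 * i)) * int ((k - i + b) choose b))"
    by (rule binomial_sum_reindex) (auto simp: binom_def nat_mult_distrib)
  also have "\<dots> = (\<Sum>i<2 * Suc k. if even i then int (b choose i) * int ((k - i div 2 + b) choose b) else 0)"
    by (subst sum_lessThan_double) simp
  also have "\<dots> = (\<Sum>i = 0..2 * k. (- 1) ^ i * int (b choose i) *
      (if even (2 * k - i) then int (((2 * k - i) div 2 + b) choose b) else 0))"
    by (intro sum.mono_neutral_cong_right)
       (auto elim!: evenE simp: less_Suc_eq div_mult_self1_is_m diff_mult_distrib2[symmetric])
  finally show ?thesis
    by (simp add: reflection_coeff_fps fps_mult_nth one_minus_fps_X_power_nth even_binomial_series_def)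
qed

lemma Q_eq_reflection_coeff: "Q (int b + 2) (int k) = - reflection_coeff (Suc b) (2 * k + 1)"
proof -
  have "Q (int b + 2) (int k) = (\<Sum>i = 0..(int b + 2) div 2.
      binom (int b) (2 * i + 1) * binom (int k - i + int b) (int b))"
    by (simp add: Q_def algebra_simps)
  also have "\<dots> = (\<Sum>i<Suc k. int (b choose (2 * i + 1)) * int ((k - i + b) choose b))"
  proof (rule binomial_sum_reindex)
    fix i
    show "binom (int b) (2 * int i + 1) = int (b choose (2 * i + 1))"
      using binom_of_nat[of b "2 * i + 1"] by (simp add: algebra_simps)
  qed auto
  also have "\<dots> = (\<Sum>i<2 * Suc k. if odd i then int (b choose i) * int ((k - i div 2 + b) choose b) else 0)"
    by (subst sum_lessThan_double) simp
  also have "\<dots> = (\<Sum>i = 0..2 * k + 1. - ((- 1) ^ i * int (b choose i) *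
      (if even (2 * k + 1 - i) then int (((2 * k + 1 - i) div 2 + b) choose b) else 0)))"
  proof (intro sum.cong)
    fix i assume "i \<in> {0..2 * k + 1}"
    then show "(if odd i then int (b choose i) * int ((k - i div 2 + b) choose b) else 0) =
      - ((- 1) ^ i * int (b choose i) *
      (if even (2 * k + 1 - i) then int (((2 * k + 1 - i) div 2 + b) choose b) else 0))"
      by (auto elim!: oddE simp: diff_mult_distrib2[symmetric])
  qed auto
  also have "\<dots> = - fps_nth ((1 - fps_X) ^ b * even_binomial_series b) (2 * k + 1)"
    by (simp only: fps_mult_nth one_minus_fps_X_power_nth even_binomial_series_def fps_nth_Abs_fps sum_negf)
  finally show ?thesis
    by (simp only: reflection_coeff_fps)
qed

section \<open>Image sums\<close>

text \<open>
  The sum over the images for strip \<open>a\<close>. Each image at \<open>M + 2 * l * m\<close> is paired with the one obtained by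
  reflecting \<open>M\<close> about the next filter site \<open>(a + 1) * l - 1\<close>; both enter with a plus sign because
  the second is written at its mirror image about \<open>- 1\<close>. For \<open>K > N\<close> the omitted
  terms vanish in the strip, so \<open>K\<close> is a truncation that keeps the sum finite.
\<close>

definition image_sum :: "nat \<Rightarrow> int \<Rightarrow> nat \<Rightarrow> int \<Rightarrow> int \<Rightarrow> int" where
  "image_sum K l a N M = (\<Sum>m<K. reflection_coeff a m *
     (F N (M + 2 * l * int m) + F N (M - 2 * l * int m - 2 * (int a + 1) * l)))"

lemma image_sum_step:
  assumes "N \<ge> 0"
  shows "image_sum K l a (N + 1) M = image_sum K l a N (M - 1) + image_sum K l a N (M + 1)"
  unfolding image_sum_def sum.distrib[symmetric] F_step[OF assms]
  by (intro sum.cong) (auto simp: algebra_simps)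

text \<open>
  At the next filter site the two members of each pair are at mirror images of each other.
\<close>

lemma image_sum_right_end:
  assumes "N \<ge> 0" "M = (int a + 1) * l - 1" "even (N - M)"
  shows "image_sum K l a N M = 0"
  unfolding image_sum_def
proof (rule sum.neutral, rule ballI)
  fix m
  have "F N (M - 2 * l * int m - 2 * (int a + 1) * l) = - F N (M + 2 * l * int m)"
    using assms by (intro F_reflect) (auto simp: algebra_simps)
  then show "reflection_coeff a m *
     (F N (M + 2 * l * int m) + F N (M - 2 * l * int m - 2 * (int a + 1) * l)) = 0"
    by simp
qed

lemma less_2_mult:
  fixes l N :: int
  assumes "N \<ge> 0" "l \<ge> 2" "N < int K"
  shows "N + 1 < 2 * l * int K"
proof -
  have "4 * int K \<le> 2 * l * int K" using assms by (intro mult_right_mono) auto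
  then show ?thesis using assms by linarith
qed

text \<open>
  In the first strip all coefficients are \<open>1\<close>, and at the site left of the wall the reflected member of each
  pair cancels the direct member of the following one. What remains is \<open>F N (- 1)\<close>, which is its own
  negative, and a term beyond the range of \<open>N\<close> steps.
\<close>

lemma image_sum_wall:
  assumes "N \<ge> 0" "odd N" "l \<ge> 2" "N < int K"
  shows "image_sum K l 0 N (- 1) = 0"
proof -
  define u where "u m = F N (- 1 + 2 * l * int m)" for m
  have "image_sum K l 0 N (- 1) = (\<Sum>m<K. u m - u (Suc m))"
    unfolding image_sum_def
  proof (intro sum.cong refl)
    fix m
    have "F N (- 1 - 2 * l * int m - 2 * (int 0 + 1) * l) = - F N (- 1 + 2 * l * int (Suc m))"
      using assms by (intro F_reflect) (auto simp: algebra_simps)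
    then show "reflection_coeff 0 m * (F N (- 1 + 2 * l * int m) +
        F N (- 1 - 2 * l * int m - 2 * (int 0 + 1) * l)) = u m - u (Suc m)"
      by (simp add: u_def)
  qed
  also have "\<dots> = u 0 - u K" by (rule sum_lessThan_telescope')
  also have "u 0 = 0" using F_reflect[of N "- 1" "- 1"] assms by (simp add: u_def)
  also have "u K = 0"
    unfolding u_def using less_2_mult[OF assms(1,3,4)] by (intro F_eq_0) auto
  finally show ?thesis by simp
qed

text \<open>
  Summation by parts in the form of generating functions: pairing \<open>h\<close> with its shift multiplies the
  coefficient series by \<open>1 + t\<close>.
\<close>

lemma sum_reflection_coeff_Suc:
  assumes "h K = 0"
  shows "(\<Sum>m<K. reflection_coeff (Suc a) m * (h m + h (Suc m))) =
    (\<Sum>m<K. reflection_coeff a m * h m)"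
proof -
  have "(\<Sum>m<Suc n. reflection_coeff (Suc a) m * (h m + h (Suc m))) =
    (\<Sum>m<Suc n. reflection_coeff a m * h m) + reflection_coeff (Suc a) n * h (Suc n)" for n
    by (induction n) (auto simp: reflection_coeff_0_right algebra_simps)
  note eq = this
  show ?thesis
  proof (cases K)
    case (Suc n)
    then show ?thesis using eq[of n] assms by (simp del: sum.lessThan_Suc)
  qed simp
qed

text \<open>
  The transition from strip \<open>a\<close> to strip \<open>Suc a\<close>, whose first site is \<open>d\<close>. With \<open>h m\<close> the
  difference of the translates of \<open>F\<close> at \<open>d - 1\<close> and \<open>d + 1\<close>, the image sum of strip \<open>a\<close> at \<open>d - 1\<close>
  has the terms \<open>h m\<close>, while the difference of the image sums of strip \<open>Suc a\<close> has the terms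
  \<open>h m + h (Suc m)\<close>, because its images are reflected about a site that is \<open>l\<close> further to the right.
\<close>

lemma image_sum_filter:
  assumes "N \<ge> 0" "l \<ge> 2" "N < int K" and d: "d = (int a + 1) * l - 1" and par: "even (N + 1 - d)"
  shows "image_sum K l (Suc a) N (d - 1) = image_sum K l a N (d - 1) + image_sum K l (Suc a) N (d + 1)"
proof -
  define h where "h m = F N (d - 1 + 2 * l * int m) - F N (d + 1 + 2 * l * int m)" for m
  have "d > 0"
  proof -
    have "1 * l \<le> (int a + 1) * l" using assms(2) by (intro mult_right_mono) auto
    then show ?thesis using assms(2) d by linarith
  qed
  then have "h K = 0"
    unfolding h_def using less_2_mult[OF assms(1-3)] by (simp add: F_eq_0)
  have "image_sum K l (Suc a) N (d - 1) - image_sum K l (Suc a) N (d + 1) =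
      (\<Sum>m<K. reflection_coeff (Suc a) m * (h m + h (Suc m)))"
    unfolding image_sum_def sum_subtractf[symmetric]
  proof (intro sum.cong refl)
    fix m
    have "F N (d - 1 - 2 * l * int m - 2 * (int (Suc a) + 1) * l) = - F N (d + 1 + 2 * l * int (Suc m))"
      using assms(1) par by (intro F_reflect) (auto simp: d algebra_simps)
    moreover have "F N (d + 1 - 2 * l * int m - 2 * (int (Suc a) + 1) * l) = - F N (d - 1 + 2 * l * int (Suc m))"
      using assms(1) par by (intro F_reflect) (auto simp: d algebra_simps)
    ultimately show "reflection_coeff (Suc a) m * (F N (d - 1 + 2 * l * int m) +
          F N (d - 1 - 2 * l * int m - 2 * (int (Suc a) + 1) * l)) -
        reflection_coeff (Suc a) m * (F N (d + 1 + 2 * l * int m) +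
          F N (d + 1 - 2 * l * int m - 2 * (int (Suc a) + 1) * l)) =
        reflection_coeff (Suc a) m * (h m + h (Suc m))"
      by (simp only: h_def) (simp add: algebra_simps)
  qed
  also have "\<dots> = (\<Sum>m<K. reflection_coeff a m * h m)"
    by (rule sum_reflection_coeff_Suc) fact
  also have "\<dots> = image_sum K l a N (d - 1)"
    unfolding image_sum_def
  proof (intro sum.cong refl)
    fix m
    have "F N (d - 1 - 2 * l * int m - 2 * (int a + 1) * l) = - F N (d + 1 + 2 * l * int m)"
      using assms(1) par by (intro F_reflect) (auto simp: d algebra_simps)
    then show "reflection_coeff a m * h m = reflection_coeff a m * (F N (d - 1 + 2 * l * int m) +
        F N (d - 1 - 2 * l * int m - 2 * (int a + 1) * l))"
      by (simp add: h_def)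
  qed
  finally show ?thesis by simp
qed

lemma image_sum_0:
  assumes "l \<ge> 2" "even M" "0 \<le> M" "M \<le> (int a + 1) * l - 2" "K > 0"
  shows "image_sum K l a 0 M = (if M = 0 then 1 else 0)"
proof -
  have "image_sum K l a 0 M = (\<Sum>m<K. if m = 0 then (if M = 0 then 1 else 0) else 0)"
    unfolding image_sum_def
  proof (intro sum.cong refl)
    fix m
    have lm: "l * int m \<ge> 0" using assms by simp
    have "M - 2 * l * int m - 2 * (int a + 1) * l = M - 2 * (l * int m) - 2 * ((int a + 1) * l)"
      by (simp add: algebra_simps)
    moreover have "(int a + 1) * l > 0" using assms(1) by simp
    ultimately have "M - 2 * l * int m - 2 * (int a + 1) * l < - 2"
      using assms(4) lm by linarith
    then have "F 0 (M - 2 * l * int m - 2 * (int a + 1) * l) = 0"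
      using assms(2) by (intro F_eq_0') auto
    moreover have "F 0 (M + 2 * l * int m) = 0" if "M > 0 \<or> m > 0"
      using that assms lm by (intro F_eq_0) (auto intro: add_pos_nonneg add_nonneg_pos)
    moreover have "F 0 0 = 1" by (simp add: F_def binom_def)
    ultimately show "reflection_coeff a m *
       (F 0 (M + 2 * l * int m) + F 0 (M - 2 * l * int m - 2 * (int a + 1) * l)) =
       (if m = 0 then (if M = 0 then 1 else 0) else 0)"
      using assms(3) by (cases "m = 0"; cases "M = 0") (auto simp: reflection_coeff_0_right)
  qed
  then show ?thesis
    using assms(5) by simp
qed

section \<open>The weighted number as an image sum\<close>

lemma not_dvd_between:
  fixes l x c :: int
  assumes "c * l < x" "x < (c + 1) * l"
  shows "\<not> l dvd x"
proof
  assume "l dvd x"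
  then obtain k where "x = l * k" by (rule dvdE)
  then have "x = k * l" by (simp only: mult.commute)
  have "l > 0" using assms by (simp add: algebra_simps)
  with \<open>x = k * l\<close> assms have "c < k" "k < c + 1"
    by (auto simp: mult_less_cancel_right)
  then show False by simp
qed

text \<open>
  Columns left of the wall could only be reached through a left step from column \<open>0\<close>, which the
  wall forbids.
\<close>

lemma weighted_number_negative:
  assumes "l \<ge> 2" "x < 0"
  shows "weighted_number N (0, 0) (x, y) (filter_restrictions l) = 0"
  using assms(2)
proof (induction N arbitrary: x y)
  case 0
  then show ?case by (auto simp: weighted_number_def restricted_paths_0)
next
  case (Suc N)
  show ?case
  proof (cases "(x, y) \<in> path_lattice")
    case True
    have "step_value (filter_restrictions l) (x + 1, y - 1) (x, y) = 0" if "x = - 1"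
      using step_value_left_blocked[of l 0 "y - 1" y] assms(1) that by simp
    then have "step_value (filter_restrictions l) (x + 1, y - 1) (x, y) *
        weighted_number N (0, 0) (x + 1, y - 1) (filter_restrictions l) = 0"
      using Suc.IH[of "x + 1" "y - 1"] Suc.prems by (cases "x = - 1") auto
    then show ?thesis
      unfolding weighted_number_Suc[OF True] using Suc.IH[of "x - 1" "y - 1"] Suc.prems by simp
  qed (simp add: weighted_number_def restricted_paths_empty)
qed

text \<open>
  The first filter is crossed to the right with weight \<open>1\<close> and each later one with weight \<open>2\<close>, which
  accounts for the power \<open>2 ^ (a - 1)\<close>. The truncated subtraction makes it \<open>1\<close> in the
  first two strips, as it should be.
\<close>

lemma weighted_number_eq_image_sum:
  assumes "l \<ge> 2" "N < K" "even (int N - M)" "0 \<le> M" "int a * l - 1 \<le> M" "M \<le> (int a + 1) * l - 2"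
  shows "weighted_number N (0, 0) (M, int N) (filter_restrictions l) =
    2 ^ (a - 1) * image_sum K l a (int N) M"
  using assms(2-)
proof (induction N arbitrary: M a)
  case 0
  have "M > 0" if "a > 0"
  proof -
    have "1 * l \<le> int a * l" using that assms(1) by (intro mult_right_mono) auto
    then show ?thesis using 0 assms(1) by linarith
  qed
  then show ?case
    using 0 assms(1) image_sum_0[of l M a K]
    by (cases a) (auto simp: weighted_number_def restricted_paths_0 path_weight_def steps_def path_lattice_def)
next
  case (Suc N)
  let ?C = "filter_restrictions l"
  let ?W = "\<lambda>x. weighted_number N (0, 0) (x, int N) ?C"
  let ?S = "\<lambda>a x. image_sum K l a (int N) x"
  have lat: "(M, int (Suc N)) \<in> path_lattice"
    using Suc.prems(2) by (auto simp: path_lattice_def)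
  have rec: "weighted_number (Suc N) (0, 0) (M, int (Suc N)) ?C =
      step_value ?C (M - 1, int N) (M, int N + 1) * ?W (M - 1) +
      step_value ?C (M + 1, int N) (M, int N + 1) * ?W (M + 1)"
    using weighted_number_Suc[OF lat, of N "(0, 0)" ?C] by (simp add: add.commute)
  have Sstep: "image_sum K l a (int (Suc N)) M = ?S a (M - 1) + ?S a (M + 1)"
    using image_sum_step[of "int N" K l a M] by (simp add: add.commute)
  have par: "even (int N - (M - 1))" "even (int N - (M + 1))"
    using Suc.prems(2) by auto
  have IH: "?W x = 2 ^ (c - 1) * ?S c x"
    if "even (int N - x)" "0 \<le> x" "int c * l - 1 \<le> x" "x \<le> (int c + 1) * l - 2" for x c
    using Suc.IH[of x c] Suc.prems(1) that by simp
  have NK: "int N < int K" using Suc.prems(1) by simp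
  show ?case
  proof (cases "M = int a * l - 1")
    \<comment> \<open>The first site of a strip, which is a filter site: the step from the left comes from the
      previous strip, and the left step from the right-hand neighbour has weight \<open>2\<close>.\<close>
    case True
    then obtain b where b: "a = Suc b" using Suc.prems by (cases a) auto
    have M: "M = (int b + 1) * l - 1" using True b by (simp add: algebra_simps)
    have bl: "int b * l \<ge> 0" using assms(1) by simp
    have M': "M = int b * l + l - 1" using M by (simp add: algebra_simps)
    with bl have "M - 1 \<ge> 0" using assms(1) by linarith
    have WL: "?W (M - 1) = 2 ^ (b - 1) * ?S b (M - 1)"
      by (rule IH[OF par(1) \<open>M - 1 \<ge> 0\<close>]) (use M M' assms(1) in linarith)+
    have WR: "?W (M + 1) = 2 ^ b * ?S a (M + 1)"
      using IH[of "M + 1" a] par Suc.prems M b assms(1) by (auto simp: algebra_simps)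
    have "M + 1 = l \<longleftrightarrow> b = 0"
      using M assms(1) by (auto simp: algebra_simps)
    then have "step_value ?C (M - 1, int N) (M, int N + 1) = (if b = 0 then 1 else 2)"
      using step_value_right[of l "M - 1" "int N" "int N + 1"] assms(1) \<open>M - 1 \<ge> 0\<close> M by simp
    then have L: "step_value ?C (M - 1, int N) (M, int N + 1) * ?W (M - 1) = 2 ^ b * ?S b (M - 1)"
      by (cases b) (auto simp: WL)
    have "\<not> l dvd M + 2"
      by (rule not_dvd_between[of "int b + 1"]) (use M assms(1) in \<open>auto simp: algebra_simps\<close>)
    then have "step_value ?C (M + 1, int N) (M, int N + 1) = 2"
      using step_value_left[of l "M + 1" "int N" "int N + 1"] assms(1) \<open>M - 1 \<ge> 0\<close> M
      by (simp add: add.commute)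
    then have R: "step_value ?C (M + 1, int N) (M, int N + 1) * ?W (M + 1) = 2 ^ b * (2 * ?S a (M + 1))"
      by (simp add: WR)
    have "?S a (M - 1) = ?S b (M - 1) + ?S a (M + 1)"
      unfolding b by (rule image_sum_filter) (use assms(1) NK M par in auto)
    then show ?thesis
      unfolding rec L R Sstep by (simp add: b algebra_simps)
  next
    \<comment> \<open>Both neighbours belong to the same strip, except that the wall may be on the left and the
      next filter on the right. There one step is missing, and the image sum vanishes at the
      neighbour in question.\<close>
    case False
    then have gt: "int a * l \<le> M" using Suc.prems by linarith
    have L: "step_value ?C (M - 1, int N) (M, int N + 1) * ?W (M - 1) = 2 ^ (a - 1) * ?S a (M - 1)"
    proof (cases "M = 0")
      case True
      then have "a = 0" using gt assms(1) by (auto simp: mult_le_0_iff)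
      then show ?thesis
        using True weighted_number_negative[OF assms(1), of "- 1"] par assms(1) NK
          image_sum_wall[of "int N" l K] by simp
    next
      case False
      have "\<not> l dvd M + 1"
        by (rule not_dvd_between[of "int a"]) (use gt Suc.prems in auto)
      then have "step_value ?C (M - 1, int N) (M, int N + 1) = 1"
        using step_value_right[of l "M - 1" "int N" "int N + 1"] assms(1) False Suc.prems(3)
        by (simp add: add.commute)
      moreover have "?W (M - 1) = 2 ^ (a - 1) * ?S a (M - 1)"
        by (rule IH) (use par False gt Suc.prems in auto)
      ultimately show ?thesis by simp
    qed
    have R: "step_value ?C (M + 1, int N) (M, int N + 1) * ?W (M + 1) = 2 ^ (a - 1) * ?S a (M + 1)"
    proof (cases "M = (int a + 1) * l - 2")
      case True
      then have "l dvd M + 2" by simp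
      then have "step_value ?C (M + 1, int N) (M, int N + 1) = 0"
        using step_value_left_blocked[of l "M + 1" "int N" "int N + 1"] assms(1) Suc.prems
        by (simp add: add.commute)
      moreover have "?S a (M + 1) = 0"
        by (rule image_sum_right_end) (use True par in auto)
      ultimately show ?thesis by simp
    next
      case False
      have "\<not> l dvd M + 1" "\<not> l dvd M + 2"
        using gt Suc.prems(5) False by (intro not_dvd_between[of "int a"]; linarith)+
      then have "step_value ?C (M + 1, int N) (M, int N + 1) = 1"
        using step_value_left[of l "M + 1" "int N" "int N + 1"] assms(1) Suc.prems
        by (simp add: add.commute)
      moreover have "?W (M + 1) = 2 ^ (a - 1) * ?S a (M + 1)"
        by (rule IH) (use par False gt Suc.prems in auto)
      ultimately show ?thesis by simp
    qed
    show ?thesis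
      unfolding rec L R Sstep by (simp add: algebra_simps)
  qed
qed

theorem theorem8p2:
  fixes l j M N :: int
  assumes "l \<ge> 2" and "j \<ge> 2"
    and "(M, N) \<in> path_lattice" and "N \<ge> 0"
    and "(j - 1) * l - 1 \<le> M" and "M \<le> j * l - 2"
  shows "weighted_number (nat N) (0, 0) (M, N) (filter_restrictions l) =
    2 ^ nat (j - 2) *
      ((\<Sum>k = 0..(N - (j - 1) * l + 1) div (4 * l). P j k * F N (M + 4 * k * l))
     + (\<Sum>k = 0..(N - j * l) div (4 * l). P j k * F N (M - 4 * k * l - 2 * j * l))
     - (\<Sum>k = 0..(N - (j + 1) * l + 1) div (4 * l). Q j k * F N (M + 2 * l + 4 * k * l))
     - (\<Sum>k = 0..(N - (j + 2) * l) div (4 * l). Q j k * F N (M - 4 * k * l - 2 * (j + 1) * l)))"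
proof -
  define b where "b = nat (j - 2)"
  define K where "K = Suc (nat N)"
  have j: "j = int b + 2" using assms(2) by (simp add: b_def)
  have par: "even (N - M)" using assms(3) by (auto simp: path_lattice_def)
  have jl: "j * l \<ge> l" "(j - 1) * l \<ge> l"
    using assms(1,2) mult_right_mono[of 1 j l] mult_right_mono[of 1 "j - 1" l] by auto
  \<comment> \<open>The four upper limits stop where the values of \<open>F\<close> vanish for all \<open>M\<close> in the strip, so all four
    sums may be extended to the common range below \<open>K\<close>.\<close>
  have bound: "(N - c) div (4 * l) < int K" if "c \<ge> 0" for c
  proof -
    have "(N - c) div (4 * l) \<le> N div (4 * l)"
      using that assms(1) by (intro zdiv_mono1) auto
    also have "\<dots> \<le> N" using zdiv_mono2[of N 1 "4 * l"] assms(1,4) by simp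
    finally show ?thesis using assms(4) by (simp add: K_def)
  qed
  have beyond: "N - c < 4 * k * l" if "(N - c) div (4 * l) < k" for c k
  proof (rule ccontr)
    assume "\<not> N - c < 4 * k * l"
    then have "(k * (4 * l)) div (4 * l) \<le> (N - c) div (4 * l)"
      using assms(1) by (intro zdiv_mono1) auto
    then show False using that assms(1) by simp
  qed
  have trunc: "(\<Sum>k = 0..(N - c) div (4 * l). f k) = (\<Sum>k<K. f (int k))"
    if "c \<ge> 0" "\<And>k. N - c < 4 * k * l \<Longrightarrow> f k = 0" for c and f :: "int \<Rightarrow> int"
    by (rule sum_int_atMost_eq_lessThan) (use bound beyond that in auto)
  have M0: "M \<ge> 0" using assms(1,5) jl by linarith
  have M: "j * l - l - 1 \<le> M" "M \<le> j * l - 2"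
    using assms(5,6) by (simp_all add: algebra_simps)
  have "(\<Sum>k = 0..(N - ((j - 1) * l - 1)) div (4 * l). P j k * F N (M + 4 * k * l)) =
      (\<Sum>k<K. P j (int k) * F N (M + 4 * int k * l))"
  proof (rule trunc)
    fix k assume "N - ((j - 1) * l - 1) < 4 * k * l"
    then have "N < M + 4 * k * l" using assms(5) by linarith
    then show "P j k * F N (M + 4 * k * l) = 0" by (simp add: F_eq_0)
  qed (use jl assms(1) in linarith)
  then have 1: "(\<Sum>k = 0..(N - (j - 1) * l + 1) div (4 * l). P j k * F N (M + 4 * k * l)) =
      (\<Sum>k<K. P j (int k) * F N (M + 4 * int k * l))"
    by (simp add: algebra_simps)
  have 2: "(\<Sum>k = 0..(N - j * l) div (4 * l). P j k * F N (M - 4 * k * l - 2 * j * l)) =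
      (\<Sum>k<K. P j (int k) * F N (M - 4 * int k * l - 2 * j * l))"
  proof (rule trunc)
    fix k assume "N - j * l < 4 * k * l"
    then have "M - 4 * k * l - 2 * j * l < - N - 2" using M by linarith
    then have "F N (M - 4 * k * l - 2 * j * l) = 0"
      using assms(4) par by (intro F_eq_0') auto
    then show "P j k * F N (M - 4 * k * l - 2 * j * l) = 0" by simp
  qed (use jl assms(1) in linarith)
  have "(\<Sum>k = 0..(N - ((j + 1) * l - 1)) div (4 * l). Q j k * F N (M + 2 * l + 4 * k * l)) =
      (\<Sum>k<K. Q j (int k) * F N (M + 2 * l + 4 * int k * l))"
  proof (rule trunc)
    have *: "(j + 1) * l = j * l + l" by (simp add: algebra_simps)
    show "(j + 1) * l - 1 \<ge> 0" using * jl assms(1) by linarith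
    fix k assume "N - ((j + 1) * l - 1) < 4 * k * l"
    then have "N < M + 2 * l + 4 * k * l" using M * by linarith
    then show "Q j k * F N (M + 2 * l + 4 * k * l) = 0" by (simp add: F_eq_0)
  qed
  then have 3: "(\<Sum>k = 0..(N - (j + 1) * l + 1) div (4 * l). Q j k * F N (M + 2 * l + 4 * k * l)) =
      (\<Sum>k<K. Q j (int k) * F N (M + 2 * l + 4 * int k * l))"
    by (simp add: algebra_simps)
  have 4: "(\<Sum>k = 0..(N - (j + 2) * l) div (4 * l). Q j k * F N (M - 4 * k * l - 2 * (j + 1) * l)) =
      (\<Sum>k<K. Q j (int k) * F N (M - 4 * int k * l - 2 * (j + 1) * l))"
  proof (rule trunc)
    have *: "(j + 2) * l = j * l + 2 * l" "2 * (j + 1) * l = 2 * (j * l) + 2 * l"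
      by (simp_all add: algebra_simps)
    show "(j + 2) * l \<ge> 0" using assms(1,2) by simp
    fix k assume "N - (j + 2) * l < 4 * k * l"
    then have "M - 4 * k * l - 2 * (j + 1) * l < - N - 2" using M * by linarith
    then have "F N (M - 4 * k * l - 2 * (j + 1) * l) = 0"
      using assms(4) par by (intro F_eq_0') auto
    then show "Q j k * F N (M - 4 * k * l - 2 * (j + 1) * l) = 0" by simp
  qed
  have "weighted_number (nat N) (0, 0) (M, int (nat N)) (filter_restrictions l) =
      2 ^ (Suc b - 1) * image_sum (2 * K) l (Suc b) (int (nat N)) M"
    by (rule weighted_number_eq_image_sum)
       (use assms par j M0 in \<open>auto simp: K_def algebra_simps\<close>)
  then have "weighted_number (nat N) (0, 0) (M, N) (filter_restrictions l) =
      2 ^ b * image_sum (2 * K) l (Suc b) N M"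
    using assms(4) by simp
  also have "image_sum (2 * K) l (Suc b) N M =
      (\<Sum>k<K. P j (int k) * F N (M + 4 * int k * l) + P j (int k) * F N (M - 4 * int k * l - 2 * j * l)
       - Q j (int k) * F N (M + 2 * l + 4 * int k * l)
       - Q j (int k) * F N (M - 4 * int k * l - 2 * (j + 1) * l))"
    unfolding image_sum_def sum_lessThan_double j P_eq_reflection_coeff Q_eq_reflection_coeff
    by (intro sum.cong refl) (simp add: algebra_simps)
  also have "\<dots> = (\<Sum>k<K. P j (int k) * F N (M + 4 * int k * l))
      + (\<Sum>k<K. P j (int k) * F N (M - 4 * int k * l - 2 * j * l))
      - (\<Sum>k<K. Q j (int k) * F N (M + 2 * l + 4 * int k * l))
      - (\<Sum>k<K. Q j (int k) * F N (M - 4 * int k * l - 2 * (j + 1) * l))"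
    by (simp add: sum.distrib sum_subtractf)
  finally show ?thesis
    unfolding 1 2 3 4 b_def .
qed

end
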